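(* Let $K$ be an infinite field, $P=K[x_1,\dots,x_n]$, let $\mathcal{L}$ be a distraction matrix with entries in $P_1$, and let $I$ be a monomial ideal in $P$. (a) The vector space $D_{\mathcal{L}}(I)$ coincides with $\bigoplus_d D_{\mathcal{L}}(I_d)$, and is a homogeneous ideal in $P$. (b) Let $t_1,\dots,t_r$ be power products such that $I=(t_1,\dots,t_r)$. Then $D_{\mathcal{L}}(I)=\big(D_{\mathcal{L}}(t_1),\dots,D_{\mathcal{L}}(t_r)\big)$. (c) The Hilbert functions agree: $\mathrm{HF}_I=\mathrm{HF}_{D_{\mathcal{L}}(I)}$.
   Context: $P$ is standard graded, $P_d$ is its degree-$d$ component, $I_d=I\cap P_d$, and $\mathrm{HF}_M(d)=\dim_K M_d$. A distraction matrix is an infinite matrix $\mathcal{L}=(L_{ij}\mid i=1,\dots,n,\ j\ge 1)$ with $L_{ij}\in P_1$ such that (i) $\langle L_{1j_1},\dots,L_{nj_n}\rangle=P_1$ ($K$-linear span) for all $j_1,\dots,j_n\ge 1$; (ii) there is $N$ with $L_{ij}=L_{iN}$ for all $i$ and all $j>N$. For a power product $t=x_1^{\alpha_1}\cdots x_n^{\alpha_n}$ put $D_{\mathcal{L}}(t)=\prod_{i=1}^n\prod_{j=1}^{\alpha_i}L_{ij}$ and extend $D_{\mathcal{L}}$ to $P$ by $K$-linearity; for a $K$-subspace $V\subseteq P$, $D_{\mathcal{L}}(V)$ denotes its image. *)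

theory Defs
  imports Complex_Main "HOL-Library.Poly_Mapping"
begin

text \<open>
  The indeterminates are indexed by a finite type \<open>'n\<close>, so that \<open>n\<close> is the cardinality of \<open>'n\<close>.
  A power product is its exponent vector, and \<open>P\<close> is the monoid algebra of the power products.
\<close>

type_synonym 'n pp = "'n \<Rightarrow>\<^sub>0 nat"

type_synonym ('n, 'k) pol = "'n pp \<Rightarrow>\<^sub>0 'k"

definition pp_poly :: "'n pp \<Rightarrow> ('n, 'k::field) pol" where
  "pp_poly t = Poly_Mapping.single t 1"

definition scal :: "'k::field \<Rightarrow> ('n, 'k) pol \<Rightarrow> ('n, 'k) pol" where
  "scal c p = Poly_Mapping.single 0 c * p"

global_interpretation pol_vs: vector_space "scal :: 'k::field \<Rightarrow> ('n, 'k) pol \<Rightarrow> ('n, 'k) pol"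
  by standard
    (simp_all add: scal_def distrib_left distrib_right single_add mult_single flip: mult.assoc)

text \<open>
  For the ring regarded as a module over itself, \<open>subspace\<close> means ideal and \<open>span B\<close> is the
  ideal generated by \<open>B\<close>.
\<close>

global_interpretation pol_ideal: module "(*) :: ('n, 'k::field) pol \<Rightarrow> ('n, 'k) pol \<Rightarrow> ('n, 'k) pol"
  by standard (simp_all add: algebra_simps)

definition pp_deg :: "'n::finite pp \<Rightarrow> nat" where
  "pp_deg t = (\<Sum>i\<in>UNIV. Poly_Mapping.lookup t i)"

definition hom_comp :: "nat \<Rightarrow> ('n::finite, 'k::field) pol set" where
  "hom_comp d = {p. \<forall>t\<in>Poly_Mapping.keys p. pp_deg t = d}"

definition internal_direct_sum ::
    "(nat \<Rightarrow> ('n, 'k::field) pol set) \<Rightarrow> ('n, 'k) pol set \<Rightarrow> bool" where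
  "internal_direct_sum V W \<longleftrightarrow>
    (\<forall>d. pol_vs.subspace (V d)) \<and>
    W = {\<Sum>d\<in>{d. f d \<noteq> 0}. f d | f. (\<forall>d. f d \<in> V d) \<and> finite {d. f d \<noteq> 0}} \<and>
    (\<forall>f. (\<forall>d. f d \<in> V d) \<longrightarrow> finite {d. f d \<noteq> 0} \<longrightarrow> (\<Sum>d\<in>{d. f d \<noteq> 0}. f d) = 0 \<longrightarrow>
      (\<forall>d. f d = 0))"

definition homogeneous_ideal :: "('n::finite, 'k::field) pol set \<Rightarrow> bool" where
  "homogeneous_ideal J \<longleftrightarrow>
    pol_ideal.subspace J \<and> internal_direct_sum (\<lambda>d. J \<inter> hom_comp d) J"

definition monomial_ideal :: "('n, 'k::field) pol set \<Rightarrow> bool" where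
  "monomial_ideal I \<longleftrightarrow> (\<exists>T. I = pol_ideal.span (pp_poly ` T))"

text \<open>
  The dimension is \<open>0\<close> by convention for spaces of infinite dimension; this does not occur here, as
  each \<open>hom_comp d\<close> is spanned by finitely many power products.
\<close>

definition hilbert_fun :: "('n::finite, 'k::field) pol set \<Rightarrow> nat \<Rightarrow> nat" where
  "hilbert_fun M d = pol_vs.dim (M \<inter> hom_comp d)"

text \<open>As in the usual notation, the columns are numbered from 1; the entries \<open>L i 0\<close> are irrelevant.\<close>

definition distraction_matrix :: "('n::finite \<Rightarrow> nat \<Rightarrow> ('n, 'k::field) pol) \<Rightarrow> bool" where
  "distraction_matrix L \<longleftrightarrow>
    (\<forall>i. \<forall>j\<ge>1. L i j \<in> hom_comp 1) \<and>
    (\<forall>j. (\<forall>i. j i \<ge> 1) \<longrightarrow> pol_vs.span {L i (j i) | i. True} = hom_comp 1) \<and>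
    (\<exists>N\<ge>1. \<forall>i. \<forall>j>N. L i j = L i N)"

definition distraction_pp ::
    "('n::finite \<Rightarrow> nat \<Rightarrow> ('n, 'k::field) pol) \<Rightarrow> 'n pp \<Rightarrow> ('n, 'k) pol" where
  "distraction_pp L t = (\<Prod>i\<in>UNIV. \<Prod>j=1..Poly_Mapping.lookup t i. L i j)"

definition distraction ::
    "('n::finite \<Rightarrow> nat \<Rightarrow> ('n, 'k::field) pol) \<Rightarrow> ('n, 'k) pol \<Rightarrow> ('n, 'k) pol" where
  "distraction L p =
    (\<Sum>t\<in>Poly_Mapping.keys p. scal (Poly_Mapping.lookup p t) (distraction_pp L t))"

lemma distraction_pp_poly: "distraction L (pp_poly t) = distraction_pp L t"
  by (simp add: distraction_def pp_poly_def)

lemma lookup_scal: "Poly_Mapping.lookup (scal c p) t = c * Poly_Mapping.lookup p t"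
  by (simp add: scal_def map.rep_eq when_def flip: mult_map_scale_conv_mult)

lemma distraction_superset:
  assumes "finite A" "Poly_Mapping.keys p \<subseteq> A"
  shows "distraction L p = (\<Sum>t\<in>A. scal (Poly_Mapping.lookup p t) (distraction_pp L t))"
  unfolding distraction_def
  by (rule sum.mono_neutral_left) (use assms in \<open>auto simp: in_keys_iff\<close>)

lemma linear_distraction:
  fixes L :: "'n::finite \<Rightarrow> nat \<Rightarrow> ('n, 'k::field) pol"
  shows "Vector_Spaces.linear scal scal (distraction L)"
proof unfold_locales
  fix p q :: "('n, 'k) pol"
  let ?A = "Poly_Mapping.keys p \<union> Poly_Mapping.keys q"
  show "distraction L (p + q) = distraction L p + distraction L q"
    using Poly_Mapping.keys_add[of p q]
    by (simp add: distraction_superset[of ?A] lookup_add pol_vs.scale_left_distrib sum.distrib)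
next
  fix c :: 'k and p :: "('n, 'k) pol"
  have "Poly_Mapping.keys (scal c p) \<subseteq> Poly_Mapping.keys p"
    by (auto simp: in_keys_iff lookup_scal)
  then show "distraction L (scal c p) = scal c (distraction L p)"
    by (simp add: distraction_superset[of "Poly_Mapping.keys p"] lookup_scal pol_vs.scale_sum_right)
qed

end

theory Submission
  imports Defs "HOL-Library.FuncSet"
begin

text \<open>
  If \<open>t\<close> has exponents \<open>\<alpha>\<close>, then \<open>D(x\<^sub>i t) = L\<^sub>i\<^sub>,\<^sub>\<alpha>\<^sub>i\<^sub>+\<^sub>1 D(t)\<close>, and these \<open>n\<close> linear
  forms span \<open>P\<^sub>1\<close>. Hence the image under \<open>D\<close> of a monomial ideal absorbs \<open>P\<^sub>1\<close> and is an ideal.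
  The same computation shows that \<open>D\<close> maps \<open>P\<^sub>d\<close> onto itself; as \<open>P\<^sub>d\<close> is finite-dimensional, \<open>D\<close> is
  injective there, so that dimensions are preserved degree by degree.
\<close>

abbreviation lookup :: "('a \<Rightarrow>\<^sub>0 'b::zero) \<Rightarrow> 'a \<Rightarrow> 'b" where
  "lookup \<equiv> Poly_Mapping.lookup"

abbreviation keys :: "('a \<Rightarrow>\<^sub>0 'b::zero) \<Rightarrow> 'a set" where
  "keys \<equiv> Poly_Mapping.keys"

global_interpretation pol_pair:
  vector_space_pair "scal :: 'k::field \<Rightarrow> ('n, 'k) pol \<Rightarrow> ('n, 'k) pol"
    "scal :: 'k \<Rightarrow> ('m, 'k) pol \<Rightarrow> ('m, 'k) pol"
  by (intro vector_space_pair.intro pol_vs.vector_space_axioms)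

section \<open>Power products as a linear basis\<close>

lemma scal_mult_left: "scal c p * q = scal c (p * q)"
  by (simp only: scal_def mult.assoc)

lemma scal_mult_right: "p * scal c q = scal c (p * q)"
  by (simp only: scal_def mult.left_commute)

lemma lookup_pp_poly: "lookup (pp_poly t) s = (if s = t then 1 else 0)"
  by (simp add: pp_poly_def lookup_single when_def)

lemma pp_poly_add: "pp_poly (s + t) = pp_poly s * pp_poly t"
  by (simp add: pp_poly_def mult_single)

lemma inj_pp_poly: "inj pp_poly"
  by (rule injI) (metis lookup_pp_poly zero_neq_one)

lemma pol_eq_sum_pp_poly:
  assumes "finite A" "keys p \<subseteq> A"
  shows "p = (\<Sum>t\<in>A. scal (lookup p t) (pp_poly t))"
  by (rule poly_mapping_eqI)
    (use assms in \<open>auto simp: lookup_sum lookup_scal lookup_pp_poly in_keys_iff if_distrib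
      cong: if_cong\<close>)

lemma subspace_keys: "pol_vs.subspace {p :: ('n, 'k::field) pol. keys p \<subseteq> S}"
proof (rule pol_vs.subspaceI)
  fix p q :: "('n, 'k) pol"
  assume "p \<in> {p. keys p \<subseteq> S}" "q \<in> {p. keys p \<subseteq> S}"
  then show "p + q \<in> {p. keys p \<subseteq> S}"
    using Poly_Mapping.keys_add[of p q] by auto
next
  fix c and p :: "('n, 'k) pol"
  assume "p \<in> {p. keys p \<subseteq> S}"
  then show "scal c p \<in> {p. keys p \<subseteq> S}"
    by (auto simp: in_keys_iff lookup_scal)
qed auto

text \<open>Turns membership in a monomial span into a condition on the support. Monomial ideals and
  homogeneous components are both handled in this form.\<close>

lemma span_pp_poly:
  fixes S :: "'n pp set"
  shows "pol_vs.span (pp_poly ` S) = {p :: ('n, 'k::field) pol. keys p \<subseteq> S}"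
proof
  show "pol_vs.span (pp_poly ` S) \<subseteq> {p :: ('n, 'k) pol. keys p \<subseteq> S}"
    by (rule pol_vs.span_minimal[OF _ subspace_keys]) (auto simp: pp_poly_def)
  show "{p :: ('n, 'k) pol. keys p \<subseteq> S} \<subseteq> pol_vs.span (pp_poly ` S)"
  proof
    fix p :: "('n, 'k) pol"
    assume "p \<in> {p. keys p \<subseteq> S}"
    then show "p \<in> pol_vs.span (pp_poly ` S)"
      by (subst pol_eq_sum_pp_poly[of "keys p" p])
        (auto intro!: pol_vs.span_sum pol_vs.span_scale intro: pol_vs.span_base)
  qed
qed

lemma independent_pp_poly:
  fixes M :: "'n pp set"
  assumes "finite M"
  shows "pol_vs.independent (pp_poly ` M :: ('n, 'k::field) pol set)"
proof (rule pol_vs.independent_if_scalars_zero)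
  show "finite (pp_poly ` M :: ('n, 'k) pol set)" using assms by simp
  fix f and x :: "('n, 'k) pol"
  assume "(\<Sum>y\<in>pp_poly ` M. scal (f y) y) = (0 :: ('n, 'k) pol)" and "x \<in> pp_poly ` M"
  then obtain t where t: "t \<in> M" "x = pp_poly t"
    and "(\<Sum>s\<in>M. scal (f (pp_poly s)) (pp_poly s)) = 0"
    by (auto simp: sum.reindex[OF inj_on_subset[OF inj_pp_poly]])
  then have "lookup (\<Sum>s\<in>M. scal (f (pp_poly s)) (pp_poly s)) t = 0"
    by simp
  with t assms show "f x = 0"
    by (simp add: lookup_sum lookup_scal lookup_pp_poly if_distrib cong: if_cong)
qed

section \<open>Ideals as linear subspaces\<close>

lemma ideal_imp_subspace:
  assumes "pol_ideal.subspace J"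
  shows "pol_vs.subspace J"
  using assms
  by (intro pol_vs.subspaceI)
    (auto simp: scal_def pol_ideal.subspace_0 pol_ideal.subspace_add pol_ideal.subspace_scale)

text \<open>Every multiplier is a linear combination of power products, so in a subspace absorption
  needs to be checked only for these.\<close>

lemma ideal_of_subspace:
  fixes J :: "('n, 'k::field) pol set"
  assumes J: "pol_vs.subspace J" and mult: "\<And>u y. y \<in> J \<Longrightarrow> pp_poly u * y \<in> J"
  shows "pol_ideal.subspace J"
proof (rule pol_ideal.subspaceI)
  fix c x :: "('n, 'k) pol"
  assume "x \<in> J"
  then have "(\<Sum>t\<in>keys c. scal (lookup c t) (pp_poly t)) * x \<in> J"
    by (auto simp: sum_distrib_right scal_mult_left
        intro!: pol_vs.subspace_sum[OF J] pol_vs.subspace_scale[OF J] mult)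
  then show "c * x \<in> J"
    using pol_eq_sum_pp_poly[of "keys c" c] by simp
qed (auto simp: pol_vs.subspace_0[OF J] pol_vs.subspace_add[OF J])

text \<open>Rewrites a monomial ideal as a linear span, the form to which the merely linear map
  \<open>distraction L\<close> can be applied.\<close>

lemma ideal_span_pp_poly:
  "pol_ideal.span (pp_poly ` T) = pol_vs.span (pp_poly ` {t + u | t u. t \<in> T})"
  (is "?I = ?V")
proof
  have "pp_poly u * y \<in> ?V" if "y \<in> ?V" for u y
  proof -
    have "keys (pp_poly u * y) \<subseteq> {u + s | s. s \<in> keys y}"
      using Poly_Mapping.keys_mult[of "pp_poly u" y] by (auto simp: pp_poly_def)
    also have "\<dots> \<subseteq> {t + u | t u. t \<in> T}"
      using that unfolding span_pp_poly by (auto simp: subset_iff) (metis add.left_commute)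
    finally show ?thesis by (simp add: span_pp_poly)
  qed
  then have "pol_ideal.subspace ?V"
    by (intro ideal_of_subspace pol_vs.subspace_span)
  moreover have "pp_poly t \<in> ?V" if "t \<in> T" for t
    using that by (intro pol_vs.span_base imageI CollectI exI[of _ t] exI[of _ 0]) simp
  ultimately show "?I \<subseteq> ?V"
    by (intro pol_ideal.span_minimal) auto
  show "?V \<subseteq> ?I"
  proof (rule pol_vs.span_minimal)
    have "pp_poly (t + u) \<in> ?I" if "t \<in> T" for t u
      unfolding add.commute[of t] pp_poly_add
      using that by (intro pol_ideal.span_scale pol_ideal.span_base imageI)
    then show "pp_poly ` {t + u | t u. t \<in> T} \<subseteq> ?I"
      by auto
  qed (intro ideal_imp_subspace pol_ideal.subspace_span)
qed

section \<open>Degrees and homogeneous components\<close>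

lemma pp_deg_add: "pp_deg (s + t) = pp_deg s + pp_deg t"
  by (simp add: pp_deg_def lookup_add sum.distrib)

lemma pp_deg_single: "pp_deg (Poly_Mapping.single i m) = m"
  by (simp add: pp_deg_def lookup_single when_def)

lemma pp_deg_0: "pp_deg 0 = 0"
  by (simp add: pp_deg_def)

text \<open>Induction on the degree, removing one indeterminate at a time.\<close>

lemma pp_induct [case_names zero add]:
  fixes t :: "'n::finite pp"
  assumes "P 0" and add: "\<And>t i. P t \<Longrightarrow> P (t + Poly_Mapping.single i 1)"
  shows "P t"
proof (induction "pp_deg t" arbitrary: t)
  case 0
  then have "t = 0"
    by (intro poly_mapping_eqI) (simp add: pp_deg_def)
  with \<open>P 0\<close> show ?case by simp
next
  case (Suc d)
  then have "pp_deg t \<noteq> 0"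
    by simp
  then obtain i where i: "lookup t i \<noteq> 0"
    unfolding pp_deg_def by (rule sum.not_neutral_contains_not_neutral)
  define s where "s = t - Poly_Mapping.single i 1"
  \<comment> \<open>Subtraction of exponents truncates at 0; it is exact here because
    \<open>i\<close> has a positive exponent in \<open>t\<close>.\<close>
  have t: "t = s + Poly_Mapping.single i 1"
    by (rule poly_mapping_eqI)
      (use i in \<open>auto simp: s_def lookup_add lookup_minus lookup_single when_def\<close>)
  with Suc(2) have "d = pp_deg s"
    by (simp add: pp_deg_add pp_deg_single)
  then show ?case
    unfolding t by (intro add Suc(1))
qed

text \<open>Each exponent is bounded by the degree, so the exponent vectors lie in a finite
  box.\<close>

lemma finite_pp_deg: "finite {t :: 'n::finite pp. pp_deg t = d}"
proof (rule finite_imageD)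
  have "lookup t i \<le> pp_deg t" for t :: "'n pp" and i
    unfolding pp_deg_def by (rule member_le_sum) auto
  then have "lookup ` {t :: 'n pp. pp_deg t = d} \<subseteq> (\<Pi>\<^sub>E i\<in>UNIV. {..d})"
    by auto
  then show "finite (lookup ` {t :: 'n pp. pp_deg t = d})"
    by (rule finite_subset) (simp add: finite_PiE)
  show "inj_on lookup {t :: 'n pp. pp_deg t = d}"
    by (rule inj_onI) (simp add: poly_mapping_eqI)
qed

lemma hom_comp_eq: "hom_comp d = {p. keys p \<subseteq> {t. pp_deg t = d}}"
  by (auto simp: hom_comp_def)

lemma subspace_hom_comp: "pol_vs.subspace (hom_comp d)"
  unfolding hom_comp_eq by (rule subspace_keys)

lemma hom_comp_mult: "p \<in> hom_comp d \<Longrightarrow> q \<in> hom_comp e \<Longrightarrow> p * q \<in> hom_comp (d + e)"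
  using Poly_Mapping.keys_mult[of p q] by (fastforce simp: hom_comp_def pp_deg_add)

lemma one_in_hom_comp: "1 \<in> hom_comp 0"
  by (simp add: hom_comp_def pp_deg_0)

lemma hom_comp_prod:
  assumes "finite A" "\<And>i. i \<in> A \<Longrightarrow> f i \<in> hom_comp (d i)"
  shows "prod f A \<in> hom_comp (sum d A)"
  using assms by (induction A rule: finite_induct) (auto simp: one_in_hom_comp hom_comp_mult)

section \<open>Homogeneous parts and direct sums\<close>

definition hom_part :: "nat \<Rightarrow> ('n::finite, 'k::field) pol \<Rightarrow> ('n, 'k) pol" where
  "hom_part d p = (\<Sum>t\<in>{t. pp_deg t = d}. scal (lookup p t) (pp_poly t))"

lemma lookup_hom_part: "lookup (hom_part d p) t = (if pp_deg t = d then lookup p t else 0)"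
  by (auto simp: hom_part_def lookup_sum lookup_scal lookup_pp_poly finite_pp_deg if_distrib
      cong: if_cong)

lemma keys_hom_part: "keys (hom_part d p) = {t \<in> keys p. pp_deg t = d}"
  by (auto simp: in_keys_iff lookup_hom_part split: if_splits)

lemma hom_part_in_hom_comp: "hom_part d p \<in> hom_comp d"
  by (simp add: hom_comp_def keys_hom_part)

lemma hom_part_sum: "hom_part d (sum f A) = (\<Sum>x\<in>A. hom_part d (f x))"
  by (rule poly_mapping_eqI) (simp add: lookup_hom_part lookup_sum)

lemma hom_part_scal: "hom_part d (scal c p) = scal c (hom_part d p)"
  by (rule poly_mapping_eqI) (simp add: lookup_hom_part lookup_scal)

lemma hom_part_of_hom_comp:
  assumes "p \<in> hom_comp e"
  shows "hom_part d p = (if d = e then p else 0)"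
  by (rule poly_mapping_eqI)
    (use assms in \<open>auto simp: lookup_hom_part hom_comp_def in_keys_iff\<close>)

text \<open>Supplies the finiteness of the family of nonzero parts that
  \<open>internal_direct_sum\<close> demands.\<close>

lemma hom_part_nonzero: "{d. hom_part d p \<noteq> 0} = pp_deg ` keys p"
proof -
  have "hom_part d p \<noteq> 0 \<longleftrightarrow> d \<in> pp_deg ` keys p" for d
    unfolding keys_eq_empty[symmetric] keys_hom_part by auto
  then show ?thesis by blast
qed

lemma sum_hom_part: "(\<Sum>d\<in>{d. hom_part d p \<noteq> 0}. hom_part d p) = p"
  by (rule poly_mapping_eqI)
    (auto simp: hom_part_nonzero lookup_sum lookup_hom_part in_keys_iff image_iff)

text \<open>A polynomial is the sum of its homogeneous parts, which gives existence of the
  decomposition; uniqueness holds because \<open>hom_part d\<close> recovers the summand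
  \<open>f d\<close> from the sum.\<close>

lemma internal_direct_sum_hom_comp:
  fixes J :: "('n::finite, 'k::field) pol set"
  assumes J: "pol_vs.subspace J" and part: "\<And>d p. p \<in> J \<Longrightarrow> hom_part d p \<in> J"
  shows "internal_direct_sum (\<lambda>d. J \<inter> hom_comp d) J"
  unfolding internal_direct_sum_def
proof (intro conjI allI impI)
  show "pol_vs.subspace (J \<inter> hom_comp d)" for d
    using J subspace_hom_comp by (rule pol_vs.subspace_inter)
  show "J = {\<Sum>d\<in>{d. f d \<noteq> 0}. f d | f. (\<forall>d. f d \<in> J \<inter> hom_comp d) \<and> finite {d. f d \<noteq> 0}}"
    (is "_ = ?S")
  proof
    show "J \<subseteq> ?S"
    proof
      fix p assume p: "p \<in> J"
      show "p \<in> ?S"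
        by (rule CollectI, rule exI[of _ "\<lambda>d. hom_part d p"])
          (use sum_hom_part[of p] in
            \<open>auto simp: hom_part_nonzero hom_part_in_hom_comp part[OF p]\<close>)
    qed
    show "?S \<subseteq> J"
      by (auto intro: pol_vs.subspace_sum[OF J])
  qed
next
  fix f d
  assume f: "\<forall>d. f d \<in> J \<inter> hom_comp d" and fin: "finite {d. f d \<noteq> 0}"
    and sum: "(\<Sum>d\<in>{d. f d \<noteq> 0}. f d) = 0"
  have "f d = (\<Sum>e\<in>{e. f e \<noteq> 0}. if d = e then f e else 0)"
    using fin by (auto simp: sum.delta)
  also have "\<dots> = (\<Sum>e\<in>{e. f e \<noteq> 0}. hom_part d (f e))"
    by (intro sum.cong refl hom_part_of_hom_comp[symmetric]) (use f in blast)
  also have "\<dots> = hom_part d 0"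
    by (simp only: hom_part_sum[symmetric] sum)
  also have "\<dots> = 0"
    by (rule poly_mapping_eqI) (simp add: lookup_hom_part)
  finally show "f d = 0" .
qed

section \<open>Distractions of power products\<close>

lemma distraction_span:
  "distraction L ` pol_vs.span (pp_poly ` S) = pol_vs.span (distraction_pp L ` S)"
  by (simp add: pol_pair.linear_span_image[OF linear_distraction, symmetric] image_image
      distraction_pp_poly)

lemma distraction_pp_0: "distraction_pp L 0 = 1"
  by (simp add: distraction_pp_def)

text \<open>In each row, D(t) uses an initial segment of the entries, which D(t + u) prolongs. Hence
  D(t) divides D(t + u), as needed for the generators in (b).\<close>

lemma distraction_pp_add:
  "distraction_pp L (t + u) =
    distraction_pp L t * (\<Prod>i\<in>UNIV. \<Prod>j=lookup t i + 1..lookup t i + lookup u i. L i j)"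
  unfolding distraction_pp_def lookup_add prod.distrib[symmetric]
  by (intro prod.cong refl prod.ub_add_nat) simp

lemma distraction_pp_add_single:
  "distraction_pp L (t + Poly_Mapping.single i 1) = L i (lookup t i + 1) * distraction_pp L t"
proof -
  \<comment> \<open>The range of \<open>j\<close> is empty in every row except row \<open>i\<close>,
    where it is a single index.\<close>
  have "(\<Prod>k\<in>UNIV. \<Prod>j=lookup t k + 1..lookup t k + lookup (Poly_Mapping.single i 1) k. L k j) =
      (\<Prod>k\<in>UNIV. if k = i then L i (lookup t i + 1) else 1)"
    by (rule prod.cong) (auto simp: lookup_single when_def)
  then show ?thesis
    by (simp add: distraction_pp_add mult.commute)
qed

lemma distraction_pp_in_hom_comp:
  assumes "distraction_matrix L"
  shows "distraction_pp L t \<in> hom_comp (pp_deg t)"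
proof -
  have "L i j \<in> hom_comp 1" if "j \<ge> 1" for i j
    using assms that by (simp add: distraction_matrix_def)
  then have "(\<Prod>j=1..lookup t i. L i j) \<in> hom_comp (lookup t i)" for i
    using hom_comp_prod[of "{1..lookup t i}" "L i" "\<lambda>_. 1"] by simp
  then show ?thesis
    unfolding distraction_pp_def pp_deg_def by (intro hom_comp_prod) simp_all
qed

text \<open>D(t) is homogeneous of the degree of \<open>t\<close>, so selecting degree
  \<open>d\<close> keeps the same terms before and after applying D.\<close>

lemma hom_part_distraction:
  assumes "distraction_matrix L"
  shows "hom_part d (distraction L p) = distraction L (hom_part d p)"
proof -
  have "hom_part d (distraction L p) =
      (\<Sum>t\<in>keys p. scal (lookup p t) (if d = pp_deg t then distraction_pp L t else 0))"
    unfolding distraction_def hom_part_sum hom_part_scal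
    by (simp add: hom_part_of_hom_comp[OF distraction_pp_in_hom_comp[OF assms]])
  also have "\<dots> = distraction L (hom_part d p)"
    by (subst distraction_superset[of "keys p" "hom_part d p"])
      (auto simp: keys_hom_part lookup_hom_part intro: sum.cong)
  finally show ?thesis .
qed

section \<open>Absorption of linear forms and the resulting ideals\<close>

lemma mult_distraction_pp_in_span:
  assumes L: "distraction_matrix L" and l: "l \<in> hom_comp 1"
  shows "l * distraction_pp L t \<in>
    pol_vs.span (range (\<lambda>i. distraction_pp L (t + Poly_Mapping.single i 1)))"
    (is "_ \<in> ?V")
proof -
  have "l \<in> pol_vs.span {L i (lookup t i + 1) | i. True}"
    using L l unfolding distraction_matrix_def
    by (elim conjE allE[of _ "\<lambda>i. lookup t i + 1"]) simp
  then show ?thesis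
  proof (induction rule: pol_vs.span_induct)
    \<comment> \<open>This case asks that the multipliers \<open>l\<close> satisfying the claim form
      a subspace; the other one treats the spanning entries of \<open>L\<close>.\<close>
    case base
    show ?case
      by (rule pol_vs.subspaceI)
        (auto simp: distrib_right scal_mult_left intro: pol_vs.span_zero pol_vs.span_add
          pol_vs.span_scale)
  next
    case (step l)
    then obtain i where l: "l = L i (lookup t i + 1)"
      by blast
    show ?case
      unfolding l distraction_pp_add_single[symmetric] by (intro pol_vs.span_base rangeI)
  qed
qed

lemma pp_poly_single_in_hom_comp: "pp_poly (Poly_Mapping.single i 1) \<in> hom_comp 1"
  by (simp add: hom_comp_def pp_poly_def pp_deg_single)

text \<open>Two sets are allowed for two uses: \<open>S' = S\<close> for a set closed under
  multiplication by indeterminates, and \<open>S\<close>, \<open>S'\<close> the power products of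
  consecutive degrees.\<close>

lemma mult_span_distraction_pp:
  assumes L: "distraction_matrix L" and l: "l \<in> hom_comp 1"
    and y: "y \<in> pol_vs.span (distraction_pp L ` S)"
    and S': "\<And>t i. t \<in> S \<Longrightarrow> t + Poly_Mapping.single i 1 \<in> S'"
  shows "l * y \<in> pol_vs.span (distraction_pp L ` S')"
  using y
proof (induction rule: pol_vs.span_induct)
  case base
  show ?case
    by (rule pol_vs.subspaceI)
      (auto simp: distrib_left scal_mult_right intro: pol_vs.span_zero pol_vs.span_add
        pol_vs.span_scale)
next
  case (step y)
  then obtain t where "t \<in> S" "y = distraction_pp L t" by auto
  then show ?case
    using mult_distraction_pp_in_span[OF L l, of t] S'
    by (auto elim!: subsetD[OF pol_vs.span_mono, rotated])
qed

lemma ideal_span_distraction_pp: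
  assumes L: "distraction_matrix L" and S: "\<And>t i. t \<in> S \<Longrightarrow> t + Poly_Mapping.single i 1 \<in> S"
  shows "pol_ideal.subspace (pol_vs.span (distraction_pp L ` S))"
proof (rule ideal_of_subspace)
  fix u y
  assume "y \<in> pol_vs.span (distraction_pp L ` S)"
  then show "pp_poly u * y \<in> pol_vs.span (distraction_pp L ` S)"
  proof (induction u arbitrary: y rule: pp_induct)
    case zero
    then show ?case by (simp add: pp_poly_def)
  next
    \<comment> \<open>The indeterminate is multiplied onto \<open>y\<close> first; the induction
      hypothesis then applies to this new element, hence \<open>y\<close> is arbitrary.\<close>
    case (add t i)
    then show ?case
      unfolding pp_poly_add mult.assoc
      by (intro add.IH mult_span_distraction_pp[OF L pp_poly_single_in_hom_comp _ S])
  qed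
qed (rule pol_vs.subspace_span)

section \<open>Bijectivity in each degree and dimensions\<close>

text \<open>This is the surjectivity of D on a homogeneous component: starting from D(1) = 1, each
  multiplication by an indeterminate leads from the span in one degree to the span in the
  next.\<close>

lemma pp_poly_in_span_distraction_pp:
  assumes L: "distraction_matrix L"
  shows "pp_poly u \<in> pol_vs.span (distraction_pp L ` {t. pp_deg t = pp_deg u})"
proof (induction u rule: pp_induct)
  case zero
  have "1 = distraction_pp L 0" by (simp add: distraction_pp_0)
  then show ?case by (auto simp: pp_poly_def intro!: pol_vs.span_base)
next
  case (add u i)
  show ?case
    unfolding pp_poly_add mult.commute[of "pp_poly u"]
    by (rule mult_span_distraction_pp[OF L pp_poly_single_in_hom_comp add])
      (simp add: pp_deg_add pp_deg_single)
qed

text \<open>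
  If \<open>D\<close> killed a nonzero element of \<open>P\<^sub>d\<close>, one of the generators \<open>D(t)\<close> of \<open>P\<^sub>d\<close> would be redundant,
  leaving fewer generators than the independent power products.
\<close>

lemma distraction_eq_0_imp:
  fixes L :: "'n::finite \<Rightarrow> nat \<Rightarrow> ('n, 'k::field) pol"
  assumes L: "distraction_matrix L" and p: "p \<in> hom_comp d" and 0: "distraction L p = 0"
  shows "p = 0"
proof (rule ccontr)
  assume "p \<noteq> 0"
  then obtain s where s: "s \<in> keys p" by fastforce
  define M :: "'n pp set" where "M = {t. pp_deg t = d}"
  have fin: "finite M" unfolding M_def by (rule finite_pp_deg)
  have pM: "keys p \<subseteq> M" using p by (simp add: M_def hom_comp_eq)
  with s have sM: "s \<in> M" by blast
  define V where "V = pol_vs.span (distraction_pp L ` (M - {s}))"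
  define c where "c = lookup p s"
  have c: "c \<noteq> 0" using s by (simp add: c_def in_keys_iff)
  have "0 = (\<Sum>t\<in>M. scal (lookup p t) (distraction_pp L t))"
    using 0 distraction_superset[OF fin pM, of L] by simp
  also have "\<dots> = scal c (distraction_pp L s) +
      (\<Sum>t\<in>M - {s}. scal (lookup p t) (distraction_pp L t))"
    unfolding c_def by (rule sum.remove[OF fin sM])
  finally have "scal c (distraction_pp L s) =
      - (\<Sum>t\<in>M - {s}. scal (lookup p t) (distraction_pp L t))"
    by (simp add: eq_neg_iff_add_eq_0)
  also have "\<dots> \<in> V"
    unfolding V_def
    by (intro pol_vs.span_neg pol_vs.span_sum pol_vs.span_scale pol_vs.span_base imageI)
  finally have "scal (inverse c) (scal c (distraction_pp L s)) \<in> V"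
    unfolding V_def by (rule pol_vs.span_scale)
  then have "distraction_pp L s \<in> V"
    using c by (simp add: pol_vs.scale_scale)
  then have "distraction_pp L ` M \<subseteq> V"
    by (auto simp: V_def intro: pol_vs.span_base)
  then have "pol_vs.span (distraction_pp L ` M) \<subseteq> V"
    unfolding V_def by (intro pol_vs.span_minimal pol_vs.subspace_span)
  moreover have "pp_poly t \<in> pol_vs.span (distraction_pp L ` M)" if "t \<in> M" for t
    using pp_poly_in_span_distraction_pp[OF L, of t] that by (simp add: M_def)
  ultimately have "pp_poly ` M \<subseteq> V"
    by blast
  then have "card (pp_poly ` M :: ('n, 'k) pol set) \<le> card (distraction_pp L ` (M - {s}))"
    using pol_vs.independent_span_bound[OF _ independent_pp_poly[OF fin]] fin
    unfolding V_def by (metis finite_Diff finite_imageI)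
  \<comment> \<open>Only an inequality, since distinct power products might so far have equal
    images.\<close>
  also have "\<dots> \<le> card (M - {s})"
    using fin by (intro card_image_le) simp
  also have "\<dots> < card M"
    using fin sM by (rule card_Diff1_less)
  finally show False
    by (simp add: card_image[OF inj_on_subset[OF inj_pp_poly]])
qed

text \<open>A basis of \<open>S\<close> is mapped bijectively to a basis of the image.\<close>

lemma dim_linear_image:
  fixes f :: "('n, 'k::field) pol \<Rightarrow> ('m, 'k) pol"
  assumes f: "Vector_Spaces.linear scal scal f" and S: "pol_vs.subspace S" and inj: "inj_on f S"
  shows "pol_vs.dim (f ` S) = pol_vs.dim S"
proof -
  obtain B where B: "B \<subseteq> S" "pol_vs.independent B" "S \<subseteq> pol_vs.span B" "card B = pol_vs.dim S"
    by (rule pol_vs.basis_exists)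
  then have span: "pol_vs.span B = S"
    using S by (intro equalityI pol_vs.span_minimal)
  have "pol_vs.dim (f ` S) = card (f ` B)"
  proof (rule pol_vs.dim_eq_card)
    show "pol_vs.independent (f ` B)"
      by (rule pol_pair.linear_independent_injective_image[OF f]) (use B inj span in auto)
    show "pol_vs.span (f ` B) = pol_vs.span (f ` S)"
      by (simp add: pol_pair.linear_span_image[OF f] span pol_vs.span_eq_iff[THEN iffD2, OF S])
  qed
  then show ?thesis
    using B(1,4) card_image[OF inj_on_subset[OF inj]] by simp
qed

theorem corollary2p10:
  fixes L :: "'n::finite \<Rightarrow> nat \<Rightarrow> ('n, 'k::field) pol"
    and I :: "('n, 'k) pol set"
  assumes "infinite (UNIV :: 'k set)"
    and "distraction_matrix L"
    and "monomial_ideal I"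
  shows "(internal_direct_sum (\<lambda>d. distraction L ` (I \<inter> hom_comp d)) (distraction L ` I) \<and>
        homogeneous_ideal (distraction L ` I)) \<and>
      (\<forall>ts :: 'n pp list. I = pol_ideal.span (pp_poly ` set ts) \<longrightarrow>
        distraction L ` I = pol_ideal.span ((\<lambda>t. distraction L (pp_poly t)) ` set ts)) \<and>
      hilbert_fun I = hilbert_fun (distraction L ` I)"
proof -
  note L = assms(2)
  interpret D: Vector_Spaces.linear scal scal "distraction L"
    by (rule linear_distraction)
  \<comment> \<open>The power products lying in the monomial ideal generated by
    \<open>T\<close>.\<close>
  define up where "up T = {t + u | t u. t \<in> T}" for T :: "'n pp set"
  have image: "distraction L ` pol_ideal.span (pp_poly ` T) = pol_vs.span (distraction_pp L ` up T)"
    for T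
    by (simp add: ideal_span_pp_poly distraction_span up_def)
  have ideal: "pol_ideal.subspace (pol_vs.span (distraction_pp L ` up T))" for T
    by (rule ideal_span_distraction_pp[OF L]) (auto simp: up_def, metis add.assoc)
  obtain T where T: "I = pol_ideal.span (pp_poly ` T)"
    using assms(3) by (auto simp: monomial_ideal_def)
  \<comment> \<open>Membership in \<open>I\<close> depends on the support only, so \<open>I\<close>
    contains the homogeneous parts of its elements.\<close>
  have I: "I = {p. keys p \<subseteq> up T}"
    by (simp add: T ideal_span_pp_poly span_pp_poly up_def)
  have subspace_I: "pol_vs.subspace I"
    unfolding I by (rule subspace_keys)
  have ideal_DI: "pol_ideal.subspace (distraction L ` I)"
    unfolding T image by (rule ideal)
  have part: "hom_part d y \<in> distraction L ` (I \<inter> hom_comp d)" if "y \<in> distraction L ` I" for d y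
  proof -
    from that obtain p where p: "p \<in> I" "y = distraction L p"
      by blast
    then have "hom_part d p \<in> I \<inter> hom_comp d"
      using hom_part_in_hom_comp by (auto simp: I keys_hom_part)
    then show ?thesis
      by (simp add: p hom_part_distraction[OF L])
  qed
  \<comment> \<open>Identifies D(I_d) with the degree-\<open>d\<close> component of D(I). The two
    direct sums in (a) thereby coincide, and (c) reduces to comparing I_d with its image.\<close>
  have comp: "distraction L ` (I \<inter> hom_comp d) = distraction L ` I \<inter> hom_comp d" for d
  proof
    show "distraction L ` I \<inter> hom_comp d \<subseteq> distraction L ` (I \<inter> hom_comp d)"
    proof
      fix y assume y: "y \<in> distraction L ` I \<inter> hom_comp d"
      then have "hom_part d y = y"
        by (simp add: hom_part_of_hom_comp[of y d])
      then show "y \<in> distraction L ` (I \<inter> hom_comp d)"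
        using part[of y d] y by simp
    qed
    have "distraction L p \<in> hom_comp d" if "p \<in> hom_comp d" for p
      using hom_part_in_hom_comp[of d "distraction L p"] that
      by (simp add: hom_part_distraction[OF L] hom_part_of_hom_comp)
    then show "distraction L ` (I \<inter> hom_comp d) \<subseteq> distraction L ` I \<inter> hom_comp d"
      by auto
  qed
  have sum: "internal_direct_sum (\<lambda>d. distraction L ` I \<inter> hom_comp d) (distraction L ` I)"
    by (rule internal_direct_sum_hom_comp[OF ideal_imp_subspace[OF ideal_DI]])
      (use part in blast)
  \<comment> \<open>By \<open>image\<close>, D(I) is the linear span of all D(t + u) with
    \<open>t\<close> in \<open>U\<close>. It is an ideal containing the D(t), and D(t) divides D(t +
    u), giving the two inclusions.\<close>
  have gens: "distraction L ` I = pol_ideal.span (distraction_pp L ` U)"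
    if "I = pol_ideal.span (pp_poly ` U)" for U
    unfolding that image
  proof
    show "pol_ideal.span (distraction_pp L ` U) \<subseteq> pol_vs.span (distraction_pp L ` up U)"
    proof (rule pol_ideal.span_minimal[OF _ ideal])
      have "U \<subseteq> up U" by (auto simp: up_def) (metis add.right_neutral)
      then show "distraction_pp L ` U \<subseteq> pol_vs.span (distraction_pp L ` up U)"
        by (auto intro: pol_vs.span_base)
    qed
    have "distraction_pp L (t + u) \<in> pol_ideal.span (distraction_pp L ` U)" if "t \<in> U" for t u
      unfolding distraction_pp_add mult.commute[of "distraction_pp L t"]
      using that by (intro pol_ideal.span_scale pol_ideal.span_base imageI)
    then show "pol_vs.span (distraction_pp L ` up U) \<subseteq> pol_ideal.span (distraction_pp L ` U)"
      by (intro pol_vs.span_minimal ideal_imp_subspace pol_ideal.subspace_span)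
        (auto simp: up_def)
  qed
  \<comment> \<open>D has trivial kernel on each P_d, so it is injective on I_d and preserves its
    dimension.\<close>
  have "pol_vs.dim (I \<inter> hom_comp d) = pol_vs.dim (distraction L ` I \<inter> hom_comp d)" for d
  proof -
    have "inj_on (distraction L) (I \<inter> hom_comp d)"
    proof (rule inj_onI)
      fix p q
      assume pq: "p \<in> I \<inter> hom_comp d" "q \<in> I \<inter> hom_comp d"
        and "distraction L p = distraction L q"
      then have "distraction L (p - q) = 0"
        by (simp add: D.diff)
      moreover have "p - q \<in> hom_comp d"
        using pq by (intro pol_vs.subspace_diff[OF subspace_hom_comp]) auto
      ultimately have "p - q = 0"
        by (rule distraction_eq_0_imp[OF L, rotated])
      then show "p = q" by simp
    qed
    then show ?thesis
      unfolding comp[symmetric]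
      by (intro dim_linear_image[symmetric] linear_distraction pol_vs.subspace_inter
          subspace_I subspace_hom_comp)
  qed
  then have "hilbert_fun I = hilbert_fun (distraction L ` I)"
    by (simp add: hilbert_fun_def fun_eq_iff)
  then show ?thesis
    using sum ideal_DI gens by (simp add: comp homogeneous_ideal_def distraction_pp_poly)
qed

end
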